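(* Let $M\in\mathbb{R}^{3\times 3}$ be a singular reducible $F_0$-matrix. Then the Moore-Penrose inverse $M^{\dagger}$ is a $Z$-matrix.
   Context: Inequalities between matrices are entrywise. A real square matrix is a $Z$-matrix if all its off-diagonal entries are nonpositive; any $Z$-matrix can be written as $A=sI-B$ with $s\in\mathbb{R}$ and $B\ge 0$. Let $\rho$ denote the spectral radius, and for $B\in\mathbb{R}^{m\times m}$ let $\rho_{m-1}(B)$ be the maximum of the spectral radii of the principal submatrices of $B$ of order $m-1$. A $Z$-matrix $A=sI-B$ ($B\ge0$) of order $m$ is an $M$-matrix if $s\ge\rho(B)$, and an $N_0$-matrix if $\rho_{m-1}(B)\le s<\rho(B)$. A $Z$-matrix of order $m\ge 3$ is an $F_0$-matrix if all its principal submatrices of orders at most $m-2$ are $M$-matrices and at least one principal submatrix of order $m-1$ is an $N_0$-matrix. The Moore-Penrose inverse $M^{\dagger}$ of a real matrix $M$ is the unique matrix $X$ with $MXM=M$, $XMX=X$, $(MX)^T=MX$, $(XM)^T=XM$. *)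

theory Defs
  imports
    Jordan_Normal_Form.Spectral_Radius
    Jordan_Normal_Form.DL_Submatrix
    "HOL-Combinatorics.Permutations"
begin

definition Z_matrix :: "real mat \<Rightarrow> bool" where
  "Z_matrix A \<longleftrightarrow> square_mat A \<and>
     (\<forall>i<dim_row A. \<forall>j<dim_row A. i \<noteq> j \<longrightarrow> A $$ (i, j) \<le> 0)"

text \<open>The spectral radius of a real matrix is taken over its complex eigenvalues.\<close>

definition rho :: "real mat \<Rightarrow> real" where
  "rho B = spectral_radius (map_mat complex_of_real B)"

definition principal_submatrices :: "nat \<Rightarrow> real mat \<Rightarrow> real mat set" where
  "principal_submatrices k A =
     {submatrix A I I | I. I \<subseteq> {0..<dim_row A} \<and> card I = k}"

definition rho_minor :: "nat \<Rightarrow> real mat \<Rightarrow> real" where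
  "rho_minor k B = Max (rho ` principal_submatrices k B)"

text \<open>The order \<open>\<le>\<close> on matrices is the entrywise one. A Z-matrix has many representations
  \<open>s I - B\<close> with \<open>B \<ge> 0\<close>. Passing from \<open>(s, B)\<close> to \<open>(s + t, B + t I)\<close>, both nonnegative,
  shifts the spectral radii of \<open>B\<close> and of its principal submatrices by \<open>t\<close>
  (Perron-Frobenius), so the classes below do not depend on the representation.\<close>

definition Z_splitting :: "real mat \<Rightarrow> real \<Rightarrow> real mat \<Rightarrow> bool" where
  "Z_splitting A s B \<longleftrightarrow> B \<in> carrier_mat (dim_row A) (dim_row A) \<and>
     0\<^sub>m (dim_row A) (dim_row A) \<le> B \<and> A = s \<cdot>\<^sub>m 1\<^sub>m (dim_row A) - B"

definition M_matrix :: "real mat \<Rightarrow> bool" where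
  "M_matrix A \<longleftrightarrow> Z_matrix A \<and> (\<exists>s B. Z_splitting A s B \<and> rho B \<le> s)"

text \<open>Order at least two is required because \<open>rho_minor 0\<close> would refer to the empty spectrum
  of the matrix of order zero.\<close>

definition N0_matrix :: "real mat \<Rightarrow> bool" where
  "N0_matrix A \<longleftrightarrow> Z_matrix A \<and> 2 \<le> dim_row A \<and>
     (\<exists>s B. Z_splitting A s B \<and> rho_minor (dim_row A - 1) B \<le> s \<and> s < rho B)"

definition F0_matrix :: "real mat \<Rightarrow> bool" where
  "F0_matrix A \<longleftrightarrow> Z_matrix A \<and> 3 \<le> dim_row A \<and>
     (\<forall>k\<in>{1..dim_row A - 2}. \<forall>S\<in>principal_submatrices k A. M_matrix S) \<and>
     (\<exists>S\<in>principal_submatrices (dim_row A - 1) A. N0_matrix S)"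

text \<open>Some simultaneous permutation of rows and columns brings \<open>A\<close> to block upper triangular
  form with two nonempty square diagonal blocks.\<close>

definition reducible_matrix :: "real mat \<Rightarrow> bool" where
  "reducible_matrix A \<longleftrightarrow> square_mat A \<and>
     (\<exists>p k B C D. p permutes {0..<dim_row A} \<and> 0 < k \<and> k < dim_row A \<and>
        B \<in> carrier_mat k k \<and> C \<in> carrier_mat k (dim_row A - k) \<and>
        D \<in> carrier_mat (dim_row A - k) (dim_row A - k) \<and>
        mat (dim_row A) (dim_row A) (\<lambda>(i, j). A $$ (p i, p j)) =
          four_block_mat B C (0\<^sub>m (dim_row A - k) k) D)"

definition is_moore_penrose_inverse :: "real mat \<Rightarrow> real mat \<Rightarrow> bool" where
  "is_moore_penrose_inverse M X \<longleftrightarrow> X \<in> carrier_mat (dim_col M) (dim_row M) \<and>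
     M * X * M = M \<and> X * M * X = X \<and>
     transpose_mat (M * X) = M * X \<and> transpose_mat (X * M) = X * M"

definition moore_penrose_inverse :: "real mat \<Rightarrow> real mat" where
  "moore_penrose_inverse M = (THE X. is_moore_penrose_inverse M X)"

end

theory Submission
  imports Defs
begin

text \<open>Some principal submatrix of order two, on indices \<open>i, j\<close>, has nonnegative diagonal and negative
  determinant, so both its off-diagonal entries are nonzero. Reducibility can then only separate the
  third index \<open>k\<close>, and singularity makes the diagonal entry at \<open>k\<close> zero: up to transposition, row
  \<open>k\<close> of \<open>M\<close> vanishes. The other two rows form a matrix \<open>R\<close> of full row rank with
  pseudoinverse \<open>R\<^sup>T (R R\<^sup>T)\<^sup>-\<^sup>1\<close>. Expanding its entries in the minors of order two of \<open>R\<close>,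
  as in the Cauchy-Binet formula, exhibits their signs.\<close>

section \<open>Uniqueness and transposition of the Moore-Penrose inverse\<close>

lemma moore_penrose_inverse_unique:
  assumes M: "M \<in> carrier_mat n m"
    and X: "is_moore_penrose_inverse M X" and Y: "is_moore_penrose_inverse M Y"
  shows "X = Y"
proof -
  have cX: "X \<in> carrier_mat m n" and cY: "Y \<in> carrier_mat m n"
    using M X Y by (auto simp: is_moore_penrose_inverse_def)
  have x: "M * X * M = M" "X * M * X = X" "(M * X)\<^sup>T = M * X" "(X * M)\<^sup>T = X * M"
    and y: "M * Y * M = M" "Y * M * Y = Y" "(M * Y)\<^sup>T = M * Y" "(Y * M)\<^sup>T = Y * M"
    using X Y by (auto simp: is_moore_penrose_inverse_def)
  have MX: "M * X \<in> carrier_mat n n" and XM: "X * M \<in> carrier_mat m m"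
    and MY: "M * Y \<in> carrier_mat n n" and YM: "Y * M \<in> carrier_mat m m"
    using M cX cY by auto
  \<comment> \<open>Since \<open>M * X\<close> and \<open>M * Y\<close> are symmetric,
    \<open>(M * Y) * (M * X)\<close>, which is \<open>M * X\<close>, is the transpose of
    \<open>(M * X) * (M * Y)\<close>, which is \<open>M * Y\<close>. So these projections agree; the
    same argument on the other side gives \<open>X * M = Y * M\<close>.\<close>
  have "M * X = (M * Y * M) * X" using y by simp
  also have "\<dots> = (M * Y) * (M * X)"
    by (rule assoc_mult_mat[OF MY M cX])
  also have "\<dots> = ((M * X) * (M * Y))\<^sup>T"
    using transpose_mult[OF MX MY] x y by simp
  also have "(M * X) * (M * Y) = M * Y"
    using assoc_mult_mat[OF MX M cY] x by simp
  finally have right: "M * X = M * Y" using y by simp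
  have "X * M = X * (M * Y * M)" using y by simp
  also have "\<dots> = (X * M) * (Y * M)"
    using assoc_mult_mat[OF M cY M] assoc_mult_mat[OF cX M YM] by simp
  also have "\<dots> = ((Y * M) * (X * M))\<^sup>T"
    using transpose_mult[OF YM XM] x y by simp
  also have "(Y * M) * (X * M) = Y * M"
    using assoc_mult_mat[OF cY M XM] assoc_mult_mat[OF M cX M] x by simp
  finally have left: "X * M = Y * M" using y by simp
  have "X = (Y * M) * X" using x left by simp
  also have "\<dots> = Y * (M * Y)" using assoc_mult_mat[OF cY M cX] right by simp
  also have "\<dots> = Y" using assoc_mult_mat[OF cY M cY] y by simp
  finally show ?thesis .
qed

lemma moore_penrose_inverse_eqI:
  assumes "is_moore_penrose_inverse M X"
  shows "moore_penrose_inverse M = X"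
  unfolding moore_penrose_inverse_def
  using assms moore_penrose_inverse_unique[OF carrier_matI[OF refl refl]]
  by (intro the_equality) auto

text \<open>Transposition preserves the first two Penrose equations and exchanges the two symmetry
  conditions. It lets a vanishing column be treated as a vanishing row.\<close>

lemma is_moore_penrose_inverse_transpose:
  assumes X: "is_moore_penrose_inverse M X"
  shows "is_moore_penrose_inverse M\<^sup>T X\<^sup>T"
proof -
  have M: "M \<in> carrier_mat (dim_row M) (dim_col M)" by simp
  have cX: "X \<in> carrier_mat (dim_col M) (dim_row M)"
    using X by (auto simp: is_moore_penrose_inverse_def)
  have x: "M * X * M = M" "X * M * X = X" "(M * X)\<^sup>T = M * X" "(X * M)\<^sup>T = X * M"
    using X by (auto simp: is_moore_penrose_inverse_def)
  have MX: "M\<^sup>T * X\<^sup>T = X * M" and XM: "X\<^sup>T * M\<^sup>T = M * X"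
    using transpose_mult[OF cX M] transpose_mult[OF M cX] x by auto
  have "M\<^sup>T * X\<^sup>T * M\<^sup>T = M\<^sup>T * (M * X)\<^sup>T"
    using transpose_mult[OF M cX] M cX
    by (metis assoc_mult_mat transpose_carrier_mat)
  also have "\<dots> = (M * X * M)\<^sup>T"
    using transpose_mult[of "M * X" _ _ M] M cX by (metis mult_carrier_mat)
  finally have 1: "M\<^sup>T * X\<^sup>T * M\<^sup>T = M\<^sup>T" using x by simp
  have "X\<^sup>T * M\<^sup>T * X\<^sup>T = X\<^sup>T * (X * M)\<^sup>T"
    using transpose_mult[OF cX M] M cX
    by (metis assoc_mult_mat transpose_carrier_mat)
  also have "\<dots> = (X * M * X)\<^sup>T"
    using transpose_mult[of "X * M" _ _ X] M cX by (metis mult_carrier_mat)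
  finally have 2: "X\<^sup>T * M\<^sup>T * X\<^sup>T = X\<^sup>T" using x by simp
  show ?thesis
    unfolding is_moore_penrose_inverse_def 1 2 unfolding MX XM using x cX by auto
qed

lemma Z_matrix_transpose: "Z_matrix A\<^sup>T \<longleftrightarrow> Z_matrix A"
  by (auto simp: Z_matrix_def)

text \<open>A version of \<open>R\<^sup>T (R R\<^sup>T)\<^sup>-\<^sup>1\<close> for matrices without
  full row rank: \<open>E\<close> is the orthogonal projection onto the column space of
  \<open>M\<close>, and \<open>P\<close> inverts the Gram matrix there. Zero rows can thus stay in
  \<open>M\<close> instead of being deleted.\<close>

lemma is_moore_penrose_inverse_via_gram:
  assumes M: "M \<in> carrier_mat n m" and P: "P \<in> carrier_mat n n" and E: "E \<in> carrier_mat n n"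
    and sym: "P\<^sup>T = P" "E\<^sup>T = E" and gram: "M * M\<^sup>T * P = E" and id: "E * M = M" "P * E = P"
  shows "is_moore_penrose_inverse M (M\<^sup>T * P)"
proof -
  have T: "M\<^sup>T \<in> carrier_mat m n" and X: "M\<^sup>T * P \<in> carrier_mat m n"
    using M P by auto
  have MX: "M * (M\<^sup>T * P) = E" using gram assoc_mult_mat[OF M T P] by simp
  have "M\<^sup>T * P * M * (M\<^sup>T * P) = M\<^sup>T * P * E" using assoc_mult_mat[OF X M X] MX by simp
  also have "\<dots> = M\<^sup>T * P" using assoc_mult_mat[OF T P E] id by simp
  finally have XMX: "M\<^sup>T * P * M * (M\<^sup>T * P) = M\<^sup>T * P" .
  have "(M\<^sup>T * P * M)\<^sup>T = M\<^sup>T * (P\<^sup>T * M)"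
    using transpose_mult[OF X M] transpose_mult[OF T P] by simp
  also have "\<dots> = M\<^sup>T * P * M" using assoc_mult_mat[OF T P M] sym by simp
  finally show ?thesis
    unfolding is_moore_penrose_inverse_def using MX XMX X M sym id by auto
qed

section \<open>Matrices of order three, with 0, 1, 2 listed in an arbitrary order\<close>

lemma sum_three:
  assumes "i < 3" "j < 3" "k < 3" "distinct [i, j, k :: nat]"
  shows "sum f {0..<3} = f i + f j + (f k :: 'a :: comm_monoid_add)"
proof -
  have "{0..<3} = {i, j, k}" using assms by auto
  thus ?thesis using assms by (simp add: add.assoc)
qed

text \<open>Expanding in the order \<open>i\<close>, \<open>j\<close>, \<open>k\<close>, whatever
  their numerical values, replaces a renumbering of rows and columns or a case split over the six
  permutations.\<close>

lemma mult_mat_three: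
  assumes "A \<in> carrier_mat n 3" "B \<in> carrier_mat 3 m" "p < n" "q < m"
    and "i < 3" "j < 3" "k < 3" "distinct [i, j, k :: nat]"
  shows "(A * B) $$ (p, q) = A $$ (p, i) * B $$ (i, q) + A $$ (p, j) * B $$ (j, q) +
    A $$ (p, k) * (B $$ (k, q) :: 'a :: comm_semiring_0)"
  using assms(1-4) sum_three[OF assms(5-8)] by (simp add: scalar_prod_def)

lemma eq_mat_three:
  assumes "A \<in> carrier_mat 3 3" "B \<in> carrier_mat 3 3"
    and "i < 3" "j < 3" "k < 3" "distinct [i, j, k :: nat]"
    and "\<And>p q. p \<in> {i, j, k} \<Longrightarrow> q \<in> {i, j, k} \<Longrightarrow> A $$ (p, q) = B $$ (p, q)"
  shows "A = B"
proof (rule eq_matI)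
  fix p q assume "p < dim_row B" "q < dim_col B"
  hence "p < 3" "q < 3" using assms by auto
  hence "p \<in> {i, j, k}" "q \<in> {i, j, k}" using assms(3-6) by auto
  thus "A $$ (p, q) = B $$ (p, q)" by (rule assms)
qed (use assms in auto)

section \<open>Signs in the pseudoinverse of a matrix with one zero row\<close>

text \<open>For rows \<open>(a, b, e)\<close> and \<open>(c, d, f)\<close> in columns
  \<open>i, j, k\<close>, these are the pseudoinverse entries at \<open>(i, j)\<close> and
  \<open>(k, j)\<close>, up to division by the Gram determinant. Each is a combination of minors of
  order two, and the hypotheses fix the sign of every minor that occurs.\<close>

lemma gram_pseudoinverse_sign:
  fixes a b c d e f :: real
  assumes "a \<ge> 0" "d \<ge> 0" "b \<le> 0" "c \<le> 0" "e \<le> 0" "f \<le> 0" "a * d < b * c"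
  shows "c * (a\<^sup>2 + b\<^sup>2 + e\<^sup>2) - a * (a * c + b * d + e * f) \<le> 0"
    and "f * (a\<^sup>2 + b\<^sup>2 + e\<^sup>2) - e * (a * c + b * d + e * f) \<le> 0"
proof -
  have ce: "c * e - a * f \<ge> 0" and bf: "b * f - d * e \<ge> 0"
    using assms mult_nonpos_nonpos[of c e] mult_nonneg_nonpos[of a f]
      mult_nonpos_nonpos[of b f] mult_nonneg_nonpos[of d e] by auto
  have "b * (b * c - a * d) \<le> 0" "e * (c * e - a * f) \<le> 0"
    using assms ce by (auto intro: mult_nonpos_nonneg)
  moreover have "c * (a\<^sup>2 + b\<^sup>2 + e\<^sup>2) - a * (a * c + b * d + e * f) =
      b * (b * c - a * d) + e * (c * e - a * f)"
    by (simp add: algebra_simps power2_eq_square)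
  ultimately show "c * (a\<^sup>2 + b\<^sup>2 + e\<^sup>2) - a * (a * c + b * d + e * f) \<le> 0" by simp
  have "a * (c * e - a * f) \<ge> 0" "b * (b * f - d * e) \<le> 0"
    using assms ce bf by (auto intro: mult_nonpos_nonneg)
  moreover have "f * (a\<^sup>2 + b\<^sup>2 + e\<^sup>2) - e * (a * c + b * d + e * f) =
      b * (b * f - d * e) - a * (c * e - a * f)"
    by (simp add: algebra_simps power2_eq_square)
  ultimately show "f * (a\<^sup>2 + b\<^sup>2 + e\<^sup>2) - e * (a * c + b * d + e * f) \<le> 0" by simp
qed

lemma zero_row_moore_penrose_inverse:
  fixes M :: "real mat"
  assumes M: "M \<in> carrier_mat 3 3" and Z: "Z_matrix M"
    and ijk: "i < 3" "j < 3" "k < 3" "distinct [i, j, k :: nat]"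
    and diag: "M $$ (i, i) \<ge> 0" "M $$ (j, j) \<ge> 0"
    and minor: "M $$ (i, i) * M $$ (j, j) < M $$ (i, j) * M $$ (j, i)"
    and row: "M $$ (k, i) = 0" "M $$ (k, j) = 0" "M $$ (k, k) = 0"
  obtains X where "is_moore_penrose_inverse M X" "Z_matrix X"
proof -
  define a b e c d f where "a = M $$ (i, i)" and "b = M $$ (i, j)" and "e = M $$ (i, k)"
    and "c = M $$ (j, i)" and "d = M $$ (j, j)" and "f = M $$ (j, k)"
  note m = a_def[symmetric] b_def[symmetric] c_def[symmetric] d_def[symmetric]
    e_def[symmetric] f_def[symmetric] row
  have signs: "a \<ge> 0" "d \<ge> 0" "b \<le> 0" "c \<le> 0" "e \<le> 0" "f \<le> 0" "a * d < b * c"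
    using Z M diag minor ijk by (auto simp: Z_matrix_def a_def b_def c_def d_def e_def f_def)
  define g11 g12 g22 where "g11 = a\<^sup>2 + b\<^sup>2 + e\<^sup>2" and "g12 = a * c + b * d + e * f"
    and "g22 = c\<^sup>2 + d\<^sup>2 + f\<^sup>2"
  define g where "g = g11 * g22 - g12\<^sup>2"
  \<comment> \<open>Lagrange's identity: the Gram determinant is the sum of the squared minors, one
    of which is nonzero.\<close>
  have "g = (a * d - b * c)\<^sup>2 + (a * f - e * c)\<^sup>2 + (b * f - e * d)\<^sup>2"
    by (simp add: g_def g11_def g12_def g22_def power2_eq_square algebra_simps)
  moreover have "(a * d - b * c)\<^sup>2 > 0" using signs by simp
  ultimately have g: "g > 0" by (simp add: add_pos_nonneg)
  \<comment> \<open>\<open>P\<close> is the inverse of the Gram matrix of rows \<open>i, j\<close>, padded by zeros.\<close>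
  define P where "P = mat 3 3 (\<lambda>(p, q).
    if p = i \<and> q = i then g22 / g else if p = j \<and> q = j then g11 / g
    else if p = k \<or> q = k then 0 else - g12 / g)"
  define E :: "real mat" where "E = mat 3 3 (\<lambda>(p, q). if p = q \<and> p \<noteq> k then 1 else 0)"
  have P: "P \<in> carrier_mat 3 3" and E: "E \<in> carrier_mat 3 3"
    by (auto simp: P_def E_def)
  have T: "M\<^sup>T \<in> carrier_mat 3 3" and MT: "M * M\<^sup>T \<in> carrier_mat 3 3"
    and X: "M\<^sup>T * P \<in> carrier_mat 3 3" using M P by auto
  have Pe: "P $$ (i, i) = g22 / g" "P $$ (i, j) = - g12 / g" "P $$ (j, i) = - g12 / g"
    "P $$ (j, j) = g11 / g" "P $$ (i, k) = 0" "P $$ (j, k) = 0"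
    "P $$ (k, i) = 0" "P $$ (k, j) = 0" "P $$ (k, k) = 0"
    using ijk by (auto simp: P_def)
  have Ee: "E $$ (i, i) = 1" "E $$ (i, j) = 0" "E $$ (j, i) = 0"
    "E $$ (j, j) = 1" "E $$ (i, k) = 0" "E $$ (j, k) = 0"
    "E $$ (k, i) = 0" "E $$ (k, j) = 0" "E $$ (k, k) = 0"
    using ijk by (auto simp: E_def)
  have Te: "M\<^sup>T $$ (p, q) = M $$ (q, p)" if "p < 3" "q < 3" for p q
    using M that by auto
  note eq = eq_mat_three[OF _ _ ijk] and mult = mult_mat_three[OF _ _ _ _ ijk]
  have "P\<^sup>T = P" by (rule eq) (use ijk P in \<open>auto simp: Pe\<close>)
  moreover have "E\<^sup>T = E" by (rule eq) (use ijk E in \<open>auto simp: Ee\<close>)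
  moreover have "M * M\<^sup>T * P = E"
  proof (rule eq)
    have G: "(M * M\<^sup>T) $$ (i, i) = g11" "(M * M\<^sup>T) $$ (i, j) = g12" "(M * M\<^sup>T) $$ (j, i) = g12"
      "(M * M\<^sup>T) $$ (j, j) = g22" "(M * M\<^sup>T) $$ (k, i) = 0" "(M * M\<^sup>T) $$ (k, j) = 0"
      using ijk by (simp_all add: mult[OF M T] Te m g11_def g12_def g22_def power2_eq_square
        mult.commute)
    fix p q assume "p \<in> {i, j, k}" "q \<in> {i, j, k}"
    moreover have "g11 * (g22 / g) - g12 * (g12 / g) = 1" "g22 * (g11 / g) - g12 * (g12 / g) = 1"
      using g by (simp_all add: g_def power2_eq_square mult.commute flip: diff_divide_distrib)
    ultimately show "(M * M\<^sup>T * P) $$ (p, q) = E $$ (p, q)"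
      using ijk by (auto simp: mult[OF MT P] G Pe Ee)
  qed (use MT P E in auto)
  moreover have "E * M = M"
    by (rule eq) (use ijk M E in \<open>auto simp: mult[OF E M] Ee m\<close>)
  moreover have "P * E = P"
    by (rule eq) (use ijk P E in \<open>auto simp: mult[OF P E] Ee Pe\<close>)
  ultimately have mp: "is_moore_penrose_inverse M (M\<^sup>T * P)"
    by (intro is_moore_penrose_inverse_via_gram[OF M P E])
  \<comment> \<open>Exchanging the roles of \<open>i\<close> and \<open>j\<close> turns
    \<open>(a, b, c, d, e, f)\<close> into \<open>(d, c, b, a, f, e)\<close>, so the sign lemma also
    covers column \<open>i\<close> of the pseudoinverse. Column \<open>k\<close> vanishes with that
    of \<open>P\<close>.\<close>
  have "d * a < c * b" using signs(7) by (simp only: mult.commute)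
  note sgn = gram_pseudoinverse_sign[OF signs]
    gram_pseudoinverse_sign[OF signs(2,1,4,3,6,5) this]
  have "(M\<^sup>T * P) $$ (i, j) = (c * g11 - a * g12) / g"
    "(M\<^sup>T * P) $$ (k, j) = (f * g11 - e * g12) / g"
    "(M\<^sup>T * P) $$ (j, i) = (b * g22 - d * g12) / g"
    "(M\<^sup>T * P) $$ (k, i) = (e * g22 - f * g12) / g"
    "(M\<^sup>T * P) $$ (i, k) = 0" "(M\<^sup>T * P) $$ (j, k) = 0"
    using ijk by (simp_all add: mult[OF T P] Te Pe m diff_divide_distrib)
  moreover have "c * g11 - a * g12 \<le> 0" "f * g11 - e * g12 \<le> 0"
    "b * g22 - d * g12 \<le> 0" "e * g22 - f * g12 \<le> 0"
    using sgn by (simp_all add: g11_def g12_def g22_def ac_simps)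
  ultimately have neg: "(M\<^sup>T * P) $$ (p, q) \<le> 0"
    if "p \<in> {i, j, k}" "q \<in> {i, j, k}" "p \<noteq> q" for p q
    using g that by (auto intro!: divide_nonpos_pos)
  have mem: "p \<in> {i, j, k}" if "p < 3" for p using ijk that by auto
  have "Z_matrix (M\<^sup>T * P)"
    unfolding Z_matrix_def square_mat.simps carrier_matD[OF X]
    by (intro conjI allI impI refl neg mem)
  with mp show ?thesis by (rule that)
qed

text \<open>The determinant of \<open>M\<close> is \<open>M $$ (k, k)\<close> times the nonzero
  minor on \<open>i, j\<close>, so singularity makes row \<open>k\<close> vanish. A kernel vector is
  used in place of this factorization, which avoids expanding the determinant in permuted
  indices.\<close>

lemma singular_block_triangular_moore_penrose_inverse:
  fixes M :: "real mat"
  assumes M: "M \<in> carrier_mat 3 3" and Z: "Z_matrix M" and det: "det M = 0"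
    and ijk: "i < 3" "j < 3" "k < 3" "distinct [i, j, k :: nat]"
    and diag: "M $$ (i, i) \<ge> 0" "M $$ (j, j) \<ge> 0"
    and minor: "M $$ (i, i) * M $$ (j, j) < M $$ (i, j) * M $$ (j, i)"
    and row: "M $$ (k, i) = 0" "M $$ (k, j) = 0"
  obtains X where "is_moore_penrose_inverse M X" "Z_matrix X"
proof -
  obtain v where v: "v \<in> carrier_vec 3" "v \<noteq> 0\<^sub>v 3" "M *\<^sub>v v = 0\<^sub>v 3"
    using det det_0_iff_vec_prod_zero_field[OF M] by auto
  have ev: "M $$ (p, i) * v $ i + M $$ (p, j) * v $ j + M $$ (p, k) * v $ k = 0"
    if "p < 3" for p
    using arg_cong[OF v(3), of "\<lambda>w. w $ p"] that M v(1)
    by (simp add: scalar_prod_def sum_three[OF ijk])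
  have "M $$ (k, k) = 0"
  proof (rule ccontr)
    assume "M $$ (k, k) \<noteq> 0"
    hence vk: "v $ k = 0" using ev[of k] ijk row by simp
    let ?D = "M $$ (i, i) * M $$ (j, j) - M $$ (i, j) * M $$ (j, i)"
    have i: "M $$ (i, i) * v $ i + M $$ (i, j) * v $ j = 0"
      and j: "M $$ (j, i) * v $ i + M $$ (j, j) * v $ j = 0"
      using ev ijk vk by auto
    \<comment> \<open>Cramer's rule for the system in \<open>v $ i\<close> and \<open>v $ j\<close>
      that remains once \<open>v $ k = 0\<close>.\<close>
    have "?D * v $ i = M $$ (j, j) * (M $$ (i, i) * v $ i + M $$ (i, j) * v $ j)
        - M $$ (i, j) * (M $$ (j, i) * v $ i + M $$ (j, j) * v $ j)"
      and "?D * v $ j = M $$ (i, i) * (M $$ (j, i) * v $ i + M $$ (j, j) * v $ j)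
        - M $$ (j, i) * (M $$ (i, i) * v $ i + M $$ (i, j) * v $ j)"
      by (simp_all add: algebra_simps)
    hence "?D * v $ i = 0" "?D * v $ j = 0" unfolding i j by simp_all
    hence "v $ i = 0" "v $ j = 0" using minor by auto
    moreover have "p \<in> {i, j, k}" if "p < 3" for p using ijk that by auto
    ultimately have "v = 0\<^sub>v 3" using vk v(1) by (intro eq_vecI) auto
    thus False using v by simp
  qed
  from zero_row_moore_penrose_inverse[OF M Z ijk diag minor row this] that
  show ?thesis by blast
qed

section \<open>Spectral radius conditions in orders one and two\<close>

lemma rho_ge_diag_order_one:
  assumes B: "B \<in> carrier_mat 1 1"
  shows "B $$ (0, 0) \<le> rho B"
proof -
  let ?C = "map_mat complex_of_real B"
  have C: "?C \<in> carrier_mat 1 1" using B by simp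
  have "eigenvalue ?C (complex_of_real (B $$ (0, 0)))"
    unfolding eigenvalue_det[OF C] det_single[OF char_matrix_closed[OF C]]
    using B by (simp add: char_matrix_def)
  hence "norm (complex_of_real (B $$ (0, 0))) \<le> rho B"
    unfolding rho_def by (intro spectral_radius_mem_max(2)[OF C] imageI) (auto simp: spectrum_def)
  thus ?thesis by simp
qed

lemma M_matrix_order_one_nonneg:
  assumes "M_matrix A" "A \<in> carrier_mat 1 1"
  shows "A $$ (0, 0) \<ge> 0"
proof -
  obtain s B where B: "B \<in> carrier_mat 1 1" and s: "rho B \<le> s" and A: "A = s \<cdot>\<^sub>m 1\<^sub>m 1 - B"
    using assms by (auto simp: M_matrix_def Z_splitting_def)
  thus ?thesis using rho_ge_diag_order_one[OF B] by simp
qed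

text \<open>An eigenvalue \<open>l\<close> satisfies \<open>(l - B $$ (0, 0)) * (l - B $$ (1, 1)) =
  B $$ (0, 1) * B $$ (1, 0)\<close>. If \<open>norm l > s\<close>, the reverse triangle inequality
  makes each factor on the left larger in norm than the nonnegative \<open>s - B $$ (p, p)\<close>,
  contradicting the bound on the minor.\<close>

lemma rho_le_of_minor_order_two:
  assumes B: "B \<in> carrier_mat 2 2" and nonneg: "\<And>p q. p < 2 \<Longrightarrow> q < 2 \<Longrightarrow> B $$ (p, q) \<ge> 0"
    and diag: "B $$ (0, 0) \<le> s" "B $$ (1, 1) \<le> s"
    and minor: "B $$ (0, 1) * B $$ (1, 0) \<le> (s - B $$ (0, 0)) * (s - B $$ (1, 1))"
  shows "rho B \<le> s"
proof (rule ccontr)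
  let ?C = "map_mat complex_of_real B"
  assume "\<not> rho B \<le> s"
  moreover have C: "?C \<in> carrier_mat 2 2" using B by simp
  ultimately obtain l where l: "eigenvalue ?C l" "norm l > s"
    using spectral_radius_mem_max(1)[OF C] unfolding rho_def by (auto simp: spectrum_def)
  then obtain v where v: "v \<in> carrier_vec 2" "v \<noteq> 0\<^sub>v 2" "?C *\<^sub>v v = l \<cdot>\<^sub>v v"
    using C by (auto simp: eigenvalue_def eigenvector_def)
  have ev: "complex_of_real (B $$ (p, 0)) * v $ 0 + complex_of_real (B $$ (p, 1)) * v $ 1 = l * v $ p"
    if "p < 2" for p
    using arg_cong[OF v(3), of "\<lambda>w. w $ p"] that B v(1)
    by (simp add: scalar_prod_def numeral_2_eq_2)
  have e0: "(l - B $$ (0, 0)) * v $ 0 = B $$ (0, 1) * v $ 1"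
    and e1: "(l - B $$ (1, 1)) * v $ 1 = B $$ (1, 0) * v $ 0"
    using ev[of 0] ev[of 1] by (simp_all add: algebra_simps)
  have n: "norm (l - B $$ (p, p)) > s - B $$ (p, p)" if "p < 2" for p
    using norm_triangle_ineq2[of l "complex_of_real (B $$ (p, p))"] nonneg[of p p] l that by simp
  have ne: "l - B $$ (0, 0) \<noteq> 0" "l - B $$ (1, 1) \<noteq> 0"
    using n[of 0] n[of 1] diag by auto
  have "v $ 0 \<noteq> 0 \<or> v $ 1 \<noteq> 0"
    using v(1,2) by (auto simp: vec_eq_iff less_2_cases_iff)
  \<comment> \<open>If one coordinate vanished, \<open>e0\<close> or \<open>e1\<close> would make
    the other vanish too. Hence \<open>v $ 0 * v $ 1\<close> can be cancelled below.\<close>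
  hence "v $ 0 \<noteq> 0" "v $ 1 \<noteq> 0" using e0 e1 ne by auto
  moreover have "(l - B $$ (0, 0)) * (l - B $$ (1, 1)) * (v $ 0 * v $ 1) =
      B $$ (0, 1) * B $$ (1, 0) * (v $ 0 * v $ 1)"
    using arg_cong2[OF e0 e1, of "(*)"] by (simp add: mult_ac)
  ultimately have "(l - B $$ (0, 0)) * (l - B $$ (1, 1)) = complex_of_real (B $$ (0, 1) * B $$ (1, 0))"
    by simp
  hence "norm (l - B $$ (0, 0)) * norm (l - B $$ (1, 1)) = B $$ (0, 1) * B $$ (1, 0)"
    using nonneg[of 0 1] nonneg[of 1 0] 
    by (metis abs_of_nonneg mult_nonneg_nonneg norm_mult norm_of_real one_less_numeral_iff
        pos2 semiring_norm(76))
  moreover have "(s - B $$ (0, 0)) * (s - B $$ (1, 1)) < norm (l - B $$ (0, 0)) * norm (l - B $$ (1, 1))"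
    using n[of 0] n[of 1] diag by (intro mult_strict_mono') auto
  ultimately show False using minor by simp
qed

text \<open>Contrapositive of the preceding criterion: with a nonnegative diagonal,
  \<open>s < rho B\<close> forces a negative determinant.\<close>

lemma N0_matrix_order_two_minor:
  assumes N0: "N0_matrix A" and A: "A \<in> carrier_mat 2 2"
    and diag: "A $$ (0, 0) \<ge> 0" "A $$ (1, 1) \<ge> 0"
  shows "A $$ (0, 0) * A $$ (1, 1) < A $$ (0, 1) * A $$ (1, 0)"
proof -
  obtain s B where B: "B \<in> carrier_mat 2 2" and nonneg: "0\<^sub>m 2 2 \<le> B"
    and AB: "A = s \<cdot>\<^sub>m 1\<^sub>m 2 - B" and s: "s < rho B"
    using N0 A by (auto simp: N0_matrix_def Z_splitting_def)
  have "\<And>p q. p < 2 \<Longrightarrow> q < 2 \<Longrightarrow> B $$ (p, q) \<ge> 0"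
    using nonneg B by (auto simp: less_eq_mat_def)
  moreover have e: "A $$ (0, 0) = s - B $$ (0, 0)" "A $$ (1, 1) = s - B $$ (1, 1)"
    "A $$ (0, 1) = - B $$ (0, 1)" "A $$ (1, 0) = - B $$ (1, 0)"
    using B unfolding AB by simp_all
  ultimately have "\<not> B $$ (0, 1) * B $$ (1, 0) \<le> (s - B $$ (0, 0)) * (s - B $$ (1, 1))"
    using rho_le_of_minor_order_two[OF B, of s] s diag by fastforce
  thus ?thesis unfolding e by simp
qed

section \<open>Entrywise consequences of singularity, the \<open>F\<^sub>0\<close> property and
  reducibility\<close>

lemma not_invertible_imp_det_zero:
  assumes "A \<in> carrier_mat n n" "\<not> invertible_mat (A :: 'a :: field mat)"
  shows "det A = 0"
proof (rule ccontr)
  assume "det A \<noteq> 0"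
  from det_non_zero_imp_unit[OF assms(1) this]
  obtain B where "B \<in> carrier_mat n n" "B * A = 1\<^sub>m n" "A * B = 1\<^sub>m n"
    by (auto simp: Units_def ring_mat_def)
  thus False using assms by (auto simp: invertible_mat_def inverts_mat_def)
qed

text \<open>In order three, the submatrices of order at most \<open>m - 2\<close> are the diagonal
  entries, so the M-matrix condition says that the diagonal is nonnegative. The
  \<open>N\<^sub>0\<close> submatrix of order two then supplies \<open>i\<close> and
  \<open>j\<close>.\<close>

lemma F0_matrix_order_three:
  assumes M: "M \<in> carrier_mat 3 3" and F0: "F0_matrix M"
  obtains i j k where "i < 3" "j < 3" "k < 3" "distinct [i, j, k :: nat]"
    "M $$ (i, i) \<ge> 0" "M $$ (j, j) \<ge> 0"
    "M $$ (i, i) * M $$ (j, j) < M $$ (i, j) * M $$ (j, i)"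
proof -
  have diag: "M $$ (p, p) \<ge> 0" if p: "p < 3" for p
  proof -
    let ?S = "submatrix M {p} {p}"
    have set: "{q. q < 3 \<and> q = p} = {p}" using p by auto
    have "?S \<in> principal_submatrices 1 M"
      using p M by (auto simp: principal_submatrices_def)
    hence "M_matrix ?S" using F0 M by (auto simp: F0_matrix_def)
    moreover have "?S \<in> carrier_mat 1 1"
      using M by (intro carrier_matI) (auto simp: dim_submatrix set)
    ultimately have "?S $$ (0, 0) \<ge> 0" by (rule M_matrix_order_one_nonneg)
    moreover have "?S $$ (0, 0) = M $$ (p, p)"
      using M by (subst submatrix_index) (auto simp: set Least_equality)
    ultimately show ?thesis by simp
  qed
  obtain I where I: "I \<subseteq> {0..<3}" "card I = 2" and N0: "N0_matrix (submatrix M I I)"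
    using F0 M by (auto simp: F0_matrix_def principal_submatrices_def)
  have set: "{q. q < 3 \<and> q \<in> I} = I" using I by auto
  \<comment> \<open>\<open>pick\<close> enumerates \<open>I\<close> in increasing order, as
    \<open>submatrix\<close> does.\<close>
  define i j where "i = pick I 0" and "j = pick I 1"
  have ij: "i < j" "i < 3" "j < 3"
    using pick_mono_le[of 1 I 0] pick_in_set_le[of 0 I] pick_in_set_le[of 1 I] I
    unfolding i_def j_def by (auto simp del: pick.simps)
  have dim: "submatrix M I I \<in> carrier_mat 2 2"
    using M I by (intro carrier_matI) (auto simp: dim_submatrix set)
  have "submatrix M I I $$ (p, q) = M $$ (pick I p, pick I q)" if "p < 2" "q < 2" for p q
    using M I that by (intro submatrix_index) (auto simp: set)
  hence S: "submatrix M I I $$ (0, 0) = M $$ (i, i)" "submatrix M I I $$ (0, 1) = M $$ (i, j)"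
    "submatrix M I I $$ (1, 0) = M $$ (j, i)" "submatrix M I I $$ (1, 1) = M $$ (j, j)"
    unfolding i_def j_def by auto
  have "M $$ (i, i) * M $$ (j, j) < M $$ (i, j) * M $$ (j, i)"
    using N0_matrix_order_two_minor[OF N0 dim, unfolded S] diag ij by simp
  \<comment> \<open>The three indices 0, 1, 2 sum to 3, so the missing one is
    \<open>3 - i - j\<close>.\<close>
  moreover have "3 - i - j < 3" "i \<noteq> 3 - i - j" "j \<noteq> 3 - i - j" using ij by presburger+
  ultimately show ?thesis using that[of i j "3 - i - j"] diag ij by auto
qed

text \<open>This is reducibility without the permutation: the unit vectors indexed by
  \<open>S\<close> span a proper nonzero invariant subspace. \<open>S\<close> is the image under
  \<open>p\<close> of the first \<open>k\<close> indices, the columns of the zero block.\<close>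

lemma reducible_matrix_imp_zero_block:
  assumes M: "M \<in> carrier_mat n n" and red: "reducible_matrix M"
  obtains S where "S \<subseteq> {0..<n}" "S \<noteq> {}" "S \<noteq> {0..<n}"
    "\<And>x y. x \<in> {0..<n} - S \<Longrightarrow> y \<in> S \<Longrightarrow> M $$ (x, y) = 0"
proof -
  obtain p k B C D where p: "p permutes {0..<n}" and k: "0 < k" "k < n"
    and blocks: "B \<in> carrier_mat k k" "C \<in> carrier_mat k (n - k)" "D \<in> carrier_mat (n - k) (n - k)"
    and eq: "mat n n (\<lambda>(i, j). M $$ (p i, p j)) = four_block_mat B C (0\<^sub>m (n - k) k) D"
    using red M unfolding reducible_matrix_def by auto
  have zero: "M $$ (p i, p j) = 0" if "i < n" "j < k" "\<not> i < k" for i j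
    using arg_cong[OF eq, of "\<lambda>A. A $$ (i, j)"] that blocks k by auto
  have im: "p ` {0..<n} = {0..<n}" using p by (rule permutes_image)
  have inj: "inj p" using p by (rule permutes_inj)
  show ?thesis
  proof (rule that)
    show "p ` {0..<k} \<subseteq> {0..<n}" using k im by (metis image_mono ivl_subset le_refl less_imp_le_nat)
    show "p ` {0..<k} \<noteq> {}" using k by auto
    show "p ` {0..<k} \<noteq> {0..<n}"
    proof
      assume "p ` {0..<k} = {0..<n}"
      moreover have "card (p ` {0..<k}) = k" by (simp add: card_image inj_on_subset[OF inj])
      ultimately show False using k by simp
    qed
    fix x y assume x: "x \<in> {0..<n} - p ` {0..<k}" and y: "y \<in> p ` {0..<k}"
    from x im obtain i where "x = p i" "i < n" by (metis DiffD1 atLeastLessThan_iff imageE)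
    moreover from this x have "\<not> i < k" by auto
    ultimately show "M $$ (x, y) = 0" using y zero by auto
  qed
qed

theorem theorem4p8:
  fixes M :: "real mat"
  assumes "M \<in> carrier_mat 3 3"
    and "\<not> invertible_mat M"
    and "reducible_matrix M"
    and "F0_matrix M"
  shows "Z_matrix (moore_penrose_inverse M)"
proof -
  note M = assms(1)
  have Z: "Z_matrix M" using assms(4) by (simp add: F0_matrix_def)
  have det: "det M = 0" using not_invertible_imp_det_zero assms by blast
  obtain i j k where ijk: "i < 3" "j < 3" "k < 3" "distinct [i, j, k :: nat]"
    and diag: "M $$ (i, i) \<ge> 0" "M $$ (j, j) \<ge> 0"
    and minor: "M $$ (i, i) * M $$ (j, j) < M $$ (i, j) * M $$ (j, i)"
    using F0_matrix_order_three[OF M assms(4)] by metis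
  have "M $$ (i, i) * M $$ (j, j) \<ge> 0" using diag by simp
  hence irred: "M $$ (i, j) \<noteq> 0" "M $$ (j, i) \<noteq> 0" using minor by auto
  obtain S where S: "S \<subseteq> {0..<3}" "S \<noteq> {}" "S \<noteq> {0..<3}"
    and zero: "\<And>x y. x \<in> {0..<3} - S \<Longrightarrow> y \<in> S \<Longrightarrow> M $$ (x, y) = 0"
    using reducible_matrix_imp_zero_block[OF M assms(3)] by metis
  have U: "{0..<3} = {i, j, k}" using ijk by auto
  have ij: "i \<in> S \<longleftrightarrow> j \<in> S" using zero[of i j] zero[of j i] irred ijk by auto
  have "\<exists>X. is_moore_penrose_inverse M X \<and> Z_matrix X"
  proof (cases "k \<in> S")
    \<comment> \<open>Here \<open>S\<close> is \<open>{i, j}\<close>, and the zero block lies in row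
      \<open>k\<close>.\<close>
    case False
    hence "i \<in> S" "j \<in> S" using S ij U by auto
    hence "M $$ (k, i) = 0" "M $$ (k, j) = 0" using zero ijk False by auto
    from singular_block_triangular_moore_penrose_inverse[OF M Z det ijk diag minor this]
    show ?thesis by blast
  next
    \<comment> \<open>Here \<open>S\<close> is \<open>{k}\<close>, so column \<open>k\<close>
      vanishes off the diagonal. Passing to \<open>M\<^sup>T\<close> gives the previous situation
      and keeps the minor on \<open>i, j\<close>.\<close>
    case True
    hence "i \<notin> S" "j \<notin> S" using S ij U by auto
    hence "M $$ (i, k) = 0" "M $$ (j, k) = 0" using zero ijk True by auto
    hence row: "M\<^sup>T $$ (k, i) = 0" "M\<^sup>T $$ (k, j) = 0" using M ijk by auto
    have T: "M\<^sup>T \<in> carrier_mat 3 3" "Z_matrix M\<^sup>T" "det M\<^sup>T = 0"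
      using M Z det det_transpose[OF M] by (auto simp: Z_matrix_transpose)
    have "M\<^sup>T $$ (i, i) \<ge> 0" "M\<^sup>T $$ (j, j) \<ge> 0"
      "M\<^sup>T $$ (i, i) * M\<^sup>T $$ (j, j) < M\<^sup>T $$ (i, j) * M\<^sup>T $$ (j, i)"
      using M ijk diag minor by (auto simp: mult.commute)
    from singular_block_triangular_moore_penrose_inverse[OF T ijk this row]
    obtain X where "is_moore_penrose_inverse M\<^sup>T X" "Z_matrix X" by blast
    hence "is_moore_penrose_inverse M X\<^sup>T" "Z_matrix X\<^sup>T"
      using is_moore_penrose_inverse_transpose[of "M\<^sup>T" X] by (auto simp: Z_matrix_transpose)
    thus ?thesis by blast
  qed
  thus ?thesis using moore_penrose_inverse_eqI by metis
qed

end
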